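(* Let $K\subset\mathbb{C}$ be an arbitrary compact set, let $h(z)$ be a holomorphic function on a neighborhood of $K$, and let $f\in W$. Then there is a function $g\in W$ such that for every $x\in\mathbb{R}^d$ with $f(x)\in K$ one has $g(x)=h(f(x))$.
   Context: $W$ denotes the class of functions on $\mathbb{R}^d$ that are sums of absolutely convergent series $\sum_n c_n e^{2\pi i\langle x,\gamma_n\rangle}$ with $\gamma_n\in\mathbb{R}^d$, $c_n\in\mathbb{C}$, $\sum_n|c_n|<\infty$ (countably many terms). *)

theory Defs
  imports "HOL-Analysis.Analysis"
begin

(* The frequencies \<gamma> n need not be distinct and coefficients may vanish, so finite and
   countable sums over any index set are covered by indexing over nat. *)
definition class_W :: "(real ^ 'd \<Rightarrow> complex) set" where
  "class_W = {f. \<exists>(c :: nat \<Rightarrow> complex) (\<gamma> :: nat \<Rightarrow> real ^ 'd).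
      summable (\<lambda>n. norm (c n)) \<and>
      (\<forall>x. (\<lambda>n. c n * exp (2 * complex_of_real pi * \<i> * complex_of_real (x \<bullet> \<gamma> n))) sums f x)}"

end

theory Submission
  imports Defs "HOL-Complex_Analysis.Cauchy_Integral_Formula"
begin

text \<open>
This is a local version of the Wiener-Levy theorem. The class W is a Banach algebra under the sum
of the absolute values of the coefficients, and the proof needs two things from it.

The first is that the spectral radius of u in W equals its supremum norm. A coefficient of a
trigonometric polynomial is at most its supremum, so the norm of a trigonometric polynomial is at
most its supremum times the number of its frequencies. The n-th power of a polynomial has a number
of frequencies that is polynomial in n, which is harmless under n-th roots, and the polynomials are
dense. Hence a power series can be applied within W to every u whose values stay in a compact part
of the open disc of convergence (class_W_power_series).

The second is that W contains enough functions that are not analytic to localize. A general f in W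
need not admit cutoffs of the form \<psi>(f), but trigonometric polynomials do: for a real trigonometric
polynomial q with values in [-1, 1], a sufficiently high odd power of |q| is a series in 1 - q^2
that converges in W, by the same count of frequencies. Positive parts and quotients then yield
cutoffs of p between two levels (class_W_cutoff), and those of the squared distance of P
from z yield cutoffs for discs.

To compose h with f on the set where f lies in K, choose a trigonometric polynomial P that is
\<rho>-close to f in the norm of W, with \<rho> small compared to the distance from K to the complement
of U, and cover K by finitely many discs of radius \<rho>. Over each disc h is given by a power series,
which is applied to f - z multiplied by a cutoff in terms of P (class_W_compose_local). The finitely
many local solutions are glued by cutoffs in terms of P. All localization takes place in P, while
the composed function is built from f itself, and so the resulting identity is exact.
\<close>

section \<open>The norm of absolutely convergent exponential series\<close>

definition character :: "real ^ 'd \<Rightarrow> real ^ 'd \<Rightarrow> complex" where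
  "character \<gamma> x = exp (2 * complex_of_real pi * \<i> * complex_of_real (x \<bullet> \<gamma>))"

lemma norm_character [simp]: "norm (character \<gamma> x) = 1"
proof -
  have "character \<gamma> x = exp (\<i> * complex_of_real (2 * pi * (x \<bullet> \<gamma>)))"
    by (simp add: character_def mult_ac)
  thus ?thesis by (simp only: norm_exp_i_times)
qed

lemma character_0 [simp]: "character 0 x = 1"
  by (simp add: character_def)

lemma character_add: "character (\<gamma> + \<delta>) x = character \<gamma> x * character \<delta> x"
  by (simp add: character_def inner_add_right ring_distribs exp_add)

lemma character_shift: "character \<gamma> (x + y) = character \<gamma> x * character \<gamma> y"
  by (simp add: character_def inner_add_left ring_distribs exp_add)

lemma cnj_character: "cnj (character \<gamma> x) = character (- \<gamma>) x"
  by (simp add: character_def exp_cnj)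

text \<open>
The norm of W is the infimum of the coefficient sums over all representations of f. Only upper
bounds for it are ever needed, so it enters as a relation between a function and a bound; no
infimum has to be taken and no representation has to be made canonical.
\<close>

definition wnorm_le :: "(real ^ 'd \<Rightarrow> complex) \<Rightarrow> real \<Rightarrow> bool" where
  "wnorm_le f B \<longleftrightarrow> (\<exists>c \<gamma>. summable (\<lambda>n. norm (c n)) \<and> (\<Sum>n. norm (c n)) \<le> B \<and>
      (\<forall>x. (\<lambda>n::nat. c n * character (\<gamma> n) x) sums f x))"

lemma class_W_iff: "f \<in> class_W \<longleftrightarrow> (\<exists>B. wnorm_le f B)"
  unfolding class_W_def wnorm_le_def character_def by blast

lemma class_W_I: "wnorm_le f B \<Longrightarrow> f \<in> class_W"
  by (auto simp: class_W_iff)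

lemma wnorm_le_mono: "wnorm_le f B \<Longrightarrow> B \<le> C \<Longrightarrow> wnorm_le f C"
  unfolding wnorm_le_def by (meson order_trans)

lemma wnorm_le_bound:
  assumes "wnorm_le f B"
  shows "norm (f x) \<le> B"
proof -
  obtain c \<gamma> where c: "summable (\<lambda>n. norm (c n))" "(\<Sum>n. norm (c n)) \<le> B"
    "\<And>x. (\<lambda>n::nat. c n * character (\<gamma> n) x) sums f x"
    using assms unfolding wnorm_le_def by blast
  have "norm (f x) = norm (\<Sum>n. c n * character (\<gamma> n) x)"
    using sums_unique[OF c(3)] by metis
  also have "\<dots> \<le> (\<Sum>n. norm (c n * character (\<gamma> n) x))"
    by (rule summable_norm) (use c(1) in \<open>simp add: norm_mult\<close>)
  finally show ?thesis using c(2) by (simp add: norm_mult)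
qed

lemma wnorm_le_nonneg: "wnorm_le f B \<Longrightarrow> 0 \<le> B"
  using wnorm_le_bound[of f B undefined] norm_ge_zero order_trans by blast

lemma wnorm_le_scaled_character_times:
  assumes "wnorm_le f B"
  shows "wnorm_le (\<lambda>x. a * character \<delta> x * f x) (norm a * B)"
proof -
  obtain c \<gamma> where c: "summable (\<lambda>n. norm (c n))" "(\<Sum>n. norm (c n)) \<le> B"
    "\<And>x. (\<lambda>n::nat. c n * character (\<gamma> n) x) sums f x"
    using assms unfolding wnorm_le_def by blast
  show ?thesis unfolding wnorm_le_def
  proof (intro exI conjI allI)
    show "summable (\<lambda>n. norm (a * c n))"
      using c(1) by (simp add: norm_mult summable_mult)
    show "(\<Sum>n. norm (a * c n)) \<le> norm a * B"
      using c(1,2) by (simp add: norm_mult suminf_mult mult_left_mono)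
    show "(\<lambda>n. a * c n * character (\<delta> + \<gamma> n) x) sums (a * character \<delta> x * f x)" for x
      using sums_mult[OF c(3), of "a * character \<delta> x"] by (simp add: character_add mult_ac)
  qed
qed

lemma wnorm_le_cmult: "wnorm_le f B \<Longrightarrow> wnorm_le (\<lambda>x. a * f x) (norm a * B)"
  using wnorm_le_scaled_character_times[of f B a 0] by simp

lemma wnorm_le_0: "wnorm_le (\<lambda>x. 0) 0"
  unfolding wnorm_le_def by (intro exI[of _ "\<lambda>_. 0"]) auto

lemma wnorm_le_1: "wnorm_le (\<lambda>x. 1) 1"
  unfolding wnorm_le_def
proof (intro exI conjI allI)
  let ?c = "\<lambda>n::nat. if n = 0 then 1 else 0 :: complex"
  have "(\<lambda>n. norm (?c n)) = (\<lambda>n. if n = 0 then 1 else 0)" by auto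
  hence e: "(\<lambda>n. norm (?c n)) sums 1" using sums_single[of 0 "\<lambda>_. 1::real"] by simp
  show "summable (\<lambda>n. norm (?c n))" "(\<Sum>n. norm (?c n)) \<le> 1"
    using sums_summable[OF e] sums_unique[OF e] by auto
  show "(\<lambda>n. ?c n * character ((\<lambda>_. 0) n) x) sums 1" for x
    using sums_single[of 0 "\<lambda>_. 1::complex"] by simp
qed

text \<open>
Completeness of W: the double family of coefficients is rearranged into one sequence by the
pairing of the naturals with pairs. Closure under finite sums and under products follows from this
lemma, since a product is a series of multiples of modulated copies of one factor.
\<close>

lemma wnorm_le_suminf:
  fixes f :: "nat \<Rightarrow> real ^ 'd \<Rightarrow> complex"
  assumes f: "\<And>n. wnorm_le (f n) (B n)" and B: "summable B"
  shows "wnorm_le (\<lambda>x. \<Sum>n. f n x) (\<Sum>n. B n)"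
proof -
  obtain c \<gamma> where c: "\<And>n. summable (\<lambda>i. norm (c n i))" "\<And>n. (\<Sum>i. norm (c n i)) \<le> B n"
    "\<And>n x. (\<lambda>i::nat. c n i * character (\<gamma> n i) x) sums f n x"
    using f unfolding wnorm_le_def by metis
  have B0: "B n \<ge> 0" for n using f wnorm_le_nonneg by blast
  define C where "C = (\<lambda>(n, i). c n i)"
  define G where "G = (\<lambda>(n, i). \<gamma> n i)"
  have part: "(\<Sum>k<K. norm (C (prod_decode k))) \<le> (\<Sum>n. B n)" for K
  proof -
    define A where "A = prod_decode ` {..<K}"
    have "(\<Sum>k<K. norm (C (prod_decode k))) = (\<Sum>p\<in>A. norm (C p))"
      unfolding A_def by (subst sum.reindex) (auto simp: inj_on_def o_def prod_decode_eq)
    also have "\<dots> \<le> (\<Sum>p\<in>fst ` A \<times> snd ` A. norm (C p))"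
      by (rule sum_mono2[OF _ subset_fst_snd]) (auto simp: A_def)
    also have "\<dots> = (\<Sum>n\<in>fst ` A. \<Sum>i\<in>snd ` A. norm (c n i))"
      by (simp add: sum.cartesian_product C_def case_prod_beta)
    also have "\<dots> \<le> (\<Sum>n\<in>fst ` A. B n)"
      by (intro sum_mono order_trans[OF sum_le_suminf c(2)] c) (auto simp: A_def)
    also have "\<dots> \<le> (\<Sum>n. B n)"
      by (intro sum_le_suminf B) (auto simp: A_def B0)
    finally show ?thesis .
  qed
  have sm: "summable (\<lambda>k. norm (C (prod_decode k)))"
    by (rule summableI_nonneg_bounded[OF _ part]) simp
  show ?thesis unfolding wnorm_le_def
  proof (intro exI conjI allI)
    show "summable (\<lambda>k. norm ((C \<circ> prod_decode) k))" using sm by simp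
    show "(\<Sum>k. norm ((C \<circ> prod_decode) k)) \<le> (\<Sum>n. B n)"
      using suminf_le_const[OF sm part] by simp
    fix x
    let ?t = "\<lambda>p. C p * character (G p) x"
    have n: "summable (\<lambda>k. norm (?t (prod_decode k)))" using sm by (simp add: norm_mult)
    define S where "S = (\<Sum>k. ?t (prod_decode k))"
    have S: "(\<lambda>k. ?t (prod_decode k)) sums S"
      unfolding S_def by (rule summable_sums[OF summable_norm_cancel[OF n]])
    have "((\<lambda>k. ?t (prod_decode k)) has_sum S) UNIV"
      using norm_summable_imp_has_sum[OF n S] .
    hence "(?t has_sum S) (Sigma UNIV (\<lambda>_. UNIV))"
      using has_sum_reindex_bij_betw[OF bij_prod_decode, of ?t S] by simp
    moreover have "((\<lambda>i. ?t (n, i)) has_sum f n x) UNIV" for n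
      using norm_summable_imp_has_sum[OF _ c(3)[of n x]] c(1)[of n]
      by (simp add: C_def G_def norm_mult)
    ultimately have "((\<lambda>n. f n x) has_sum S) UNIV"
      by (rule has_sum_SigmaD)
    from sums_unique[OF has_sum_imp_sums[OF this]] have "S = (\<Sum>n. f n x)" .
    thus "(\<lambda>k. (C \<circ> prod_decode) k * character ((G \<circ> prod_decode) k) x) sums (\<Sum>n. f n x)"
      using S by simp
  qed
qed

lemma wnorm_le_add:
  assumes "wnorm_le f A" "wnorm_le g B"
  shows "wnorm_le (\<lambda>x. f x + g x) (A + B)"
proof -
  let ?F = "\<lambda>n::nat. if n = 0 then f else if n = 1 then g else (\<lambda>_. 0)"
  let ?B = "\<lambda>n::nat. if n = 0 then A else if n = 1 then B else 0"
  have "wnorm_le (\<lambda>x. \<Sum>n. ?F n x) (\<Sum>n. ?B n)"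
    by (rule wnorm_le_suminf)
       (use assms wnorm_le_0 in \<open>auto intro!: summable_finite[of "{0,1}"] split: if_splits\<close>)
  moreover have "(\<Sum>n. ?F n x) = f x + g x" for x
    by (subst suminf_finite[of "{0,1}"]) auto
  moreover have "(\<Sum>n. ?B n) = A + B"
    by (subst suminf_finite[of "{0,1}"]) auto
  ultimately show ?thesis by simp
qed

lemma wnorm_le_mult:
  assumes "wnorm_le f A" "wnorm_le g B"
  shows "wnorm_le (\<lambda>x. f x * g x) (A * B)"
proof -
  obtain c \<gamma> where c: "summable (\<lambda>n. norm (c n))" "(\<Sum>n. norm (c n)) \<le> A"
    "\<And>x. (\<lambda>n::nat. c n * character (\<gamma> n) x) sums f x"
    using assms(1) unfolding wnorm_le_def by blast
  have "wnorm_le (\<lambda>x. \<Sum>n. c n * character (\<gamma> n) x * g x) (\<Sum>n. norm (c n) * B)"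
    by (intro wnorm_le_suminf wnorm_le_scaled_character_times assms summable_mult2 c)
  moreover have "(\<Sum>n. c n * character (\<gamma> n) x * g x) = f x * g x" for x
    by (rule sums_unique[OF sums_mult2[OF c(3)], symmetric])
  moreover have "(\<Sum>n. norm (c n) * B) \<le> A * B"
    using suminf_mult2[OF c(1), of B] c(2) wnorm_le_nonneg[OF assms(2)] by (metis mult_right_mono)
  ultimately show ?thesis using wnorm_le_mono by simp
qed

lemma wnorm_le_power: "wnorm_le f A \<Longrightarrow> wnorm_le (\<lambda>x. f x ^ n) (A ^ n)"
  by (induction n) (auto intro: wnorm_le_1 wnorm_le_mult)

lemma wnorm_le_sum:
  "finite I \<Longrightarrow> (\<And>i. i \<in> I \<Longrightarrow> wnorm_le (f i) (B i)) \<Longrightarrow> wnorm_le (\<lambda>x. \<Sum>i\<in>I. f i x) (\<Sum>i\<in>I. B i)"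
  by (induction I rule: finite_induct) (auto intro: wnorm_le_0 wnorm_le_add)

lemma class_W_add: "f \<in> class_W \<Longrightarrow> g \<in> class_W \<Longrightarrow> (\<lambda>x. f x + g x) \<in> class_W"
  and class_W_mult: "f \<in> class_W \<Longrightarrow> g \<in> class_W \<Longrightarrow> (\<lambda>x. f x * g x) \<in> class_W"
  and class_W_cmult: "f \<in> class_W \<Longrightarrow> (\<lambda>x. a * f x) \<in> class_W"
  and class_W_0: "(\<lambda>x. 0) \<in> class_W"
  and class_W_1: "(\<lambda>x. 1) \<in> class_W"
  unfolding class_W_iff
  using wnorm_le_add wnorm_le_mult wnorm_le_cmult wnorm_le_0 wnorm_le_1 by blast+

lemma class_W_const: "(\<lambda>x. a) \<in> class_W"
  using class_W_cmult[OF class_W_1, of a] by simp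

lemma class_W_diff: "f \<in> class_W \<Longrightarrow> g \<in> class_W \<Longrightarrow> (\<lambda>x. f x - g x) \<in> class_W"
  using class_W_add[OF _ class_W_cmult[of g "-1"], of f] by simp

section \<open>Trigonometric polynomials\<close>

definition trig_polys :: "(real ^ 'd) set \<Rightarrow> (real ^ 'd \<Rightarrow> complex) set" where
  "trig_polys S = {f. \<exists>a. f = (\<lambda>x. \<Sum>\<gamma>\<in>S. a \<gamma> * character \<gamma> x)}"

lemma trig_polys_0: "(\<lambda>x. 0) \<in> trig_polys S"
  unfolding trig_polys_def by (auto intro!: exI[of _ "\<lambda>_. 0"])

lemma trig_polys_add: 
  assumes "f \<in> trig_polys S" "g \<in> trig_polys S"
  shows "(\<lambda>x. f x + g x) \<in> trig_polys S"
proof -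
  from assms obtain a b where "f = (\<lambda>x. \<Sum>\<gamma>\<in>S. a \<gamma> * character \<gamma> x)" 
    "g = (\<lambda>x. \<Sum>\<gamma>\<in>S. b \<gamma> * character \<gamma> x)" unfolding trig_polys_def by blast
  thus ?thesis unfolding trig_polys_def
    by (auto intro!: exI[of _ "\<lambda>\<gamma>. a \<gamma> + b \<gamma>"] simp: sum.distrib ring_distribs)
qed

lemma trig_polys_cmult: 
  assumes "f \<in> trig_polys S"
  shows "(\<lambda>x. c * f x) \<in> trig_polys S"
proof -
  from assms obtain a where "f = (\<lambda>x. \<Sum>\<gamma>\<in>S. a \<gamma> * character \<gamma> x)" 
    unfolding trig_polys_def by blast
  thus ?thesis unfolding trig_polys_def
    by (auto intro!: exI[of _ "\<lambda>\<gamma>. c * a \<gamma>"] simp: sum_distrib_left mult_ac)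
qed

lemma trig_polys_sum:
  "(\<And>i. i \<in> I \<Longrightarrow> f i \<in> trig_polys S) \<Longrightarrow> (\<lambda>x. \<Sum>i\<in>I. f i x) \<in> trig_polys S"
  by (induction I rule: infinite_finite_induct) (auto intro: trig_polys_0 trig_polys_add)

lemma trig_polys_character:
  assumes "finite S" "\<gamma> \<in> S"
  shows "(\<lambda>x. a * character \<gamma> x) \<in> trig_polys S"
  unfolding trig_polys_def using assms
  by (auto intro!: exI[of _ "\<lambda>\<delta>. if \<delta> = \<gamma> then a else 0"] simp: if_distrib if_distribR cong: if_cong)

lemma trig_polys_const:
  assumes "finite S" "0 \<in> S"
  shows "(\<lambda>x. a) \<in> trig_polys S"
  using trig_polys_character[OF assms, of a] by simp

lemma trig_polys_mono:
  assumes "f \<in> trig_polys S" "S \<subseteq> S'" "finite S'"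
  shows "f \<in> trig_polys S'"
proof -
  obtain a where "f = (\<lambda>x. \<Sum>\<gamma>\<in>S. a \<gamma> * character \<gamma> x)" 
    using assms(1) unfolding trig_polys_def by blast
  thus ?thesis
    using assms by (auto intro!: trig_polys_sum trig_polys_character)
qed

lemma trig_polys_mult:
  assumes "f \<in> trig_polys S" "g \<in> trig_polys S'" "finite S''"
    "\<And>\<gamma> \<delta>. \<gamma> \<in> S \<Longrightarrow> \<delta> \<in> S' \<Longrightarrow> \<gamma> + \<delta> \<in> S''"
  shows "(\<lambda>x. f x * g x) \<in> trig_polys S''"
proof -
  from assms obtain a b where ab: "f = (\<lambda>x. \<Sum>\<gamma>\<in>S. a \<gamma> * character \<gamma> x)" 
    "g = (\<lambda>x. \<Sum>\<gamma>\<in>S'. b \<gamma> * character \<gamma> x)" unfolding trig_polys_def by blast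
  have "(\<lambda>x. f x * g x) = (\<lambda>x. \<Sum>\<gamma>\<in>S. \<Sum>\<delta>\<in>S'. (a \<gamma> * b \<delta>) * character (\<gamma> + \<delta>) x)"
    by (simp add: ab sum_product character_add mult_ac)
  also have "\<dots> \<in> trig_polys S''"
    using assms by (intro trig_polys_sum trig_polys_character) auto
  finally show ?thesis .
qed

lemma trig_polys_cnj:
  assumes "f \<in> trig_polys S" "finite S"
  shows "(\<lambda>x. cnj (f x)) \<in> trig_polys (uminus ` S)"
proof -
  obtain a where a: "f = (\<lambda>x. \<Sum>\<gamma>\<in>S. a \<gamma> * character \<gamma> x)" 
    using assms(1) unfolding trig_polys_def by blast
  have "(\<lambda>x. cnj (f x)) = (\<lambda>x. \<Sum>\<gamma>\<in>S. cnj (a \<gamma>) * character (-\<gamma>) x)"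
    by (simp add: a cnj_character)
  also have "\<dots> \<in> trig_polys (uminus ` S)"
    using assms by (intro trig_polys_sum trig_polys_character) auto
  finally show ?thesis .
qed

text \<open>
This is the bound of a Fourier coefficient by the supremum norm, without a mean value: if the
frequency \<delta> is nonzero, there is a translation by v that changes the sign of its character.
Averaging the polynomial with its translate kills the frequency \<delta>, does not introduce others,
leaves the constant term alone and does not increase the supremum. Repeating this removes every
nonzero frequency.
\<close>

lemma constant_coeff_le_sup:
  assumes "finite S" "0 \<notin> S" 
    and "\<And>x. norm (a0 + (\<Sum>\<gamma>\<in>S. a \<gamma> * character \<gamma> x)) \<le> M"
  shows "norm a0 \<le> M"
  using assms
proof (induction S arbitrary: a rule: finite_induct)
  case empty
  then show ?case by simp
next
  case (insert \<delta> S)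
  define v where "v = (1 / (2 * (\<delta> \<bullet> \<delta>))) *\<^sub>R \<delta>"
  have "v \<bullet> \<delta> = 1/2" using insert.prems by (auto simp: v_def)
  hence "character \<delta> v = exp (complex_of_real pi * \<i>)"
    unfolding character_def by (simp only: of_real_divide) simp
  hence \<delta>: "character \<delta> v = -1" by simp
  define b where "b = (\<lambda>\<gamma>. a \<gamma> * (1 + character \<gamma> v) / 2)"
  show ?case
  proof (rule insert.IH[of b])
    show "0 \<notin> S" using insert.prems by auto
    fix x
    define Q where "Q = (\<lambda>x. a0 + (\<Sum>\<gamma>\<in>insert \<delta> S. a \<gamma> * character \<gamma> x))"
    have "a0 + (\<Sum>\<gamma>\<in>S. b \<gamma> * character \<gamma> x) = (Q x + Q (x + v)) / 2"
      using insert.hyps by (simp add: Q_def b_def character_shift \<delta> sum.distrib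
          sum_divide_distrib ring_distribs add_divide_distrib mult_ac)
    also have "norm \<dots> \<le> (norm (Q x) + norm (Q (x + v))) / 2"
      by (simp add: norm_divide norm_triangle_ineq)
    also have "\<dots> \<le> M" using insert.prems(2)[of x] insert.prems(2)[of "x + v"]
      by (simp add: Q_def del: sum.insert)
    finally show "norm (a0 + (\<Sum>\<gamma>\<in>S. b \<gamma> * character \<gamma> x)) \<le> M" .
  qed
qed

text \<open>
Each coefficient becomes the constant term after multiplication by a character of modulus one, so
all coefficients are at most M. The norm in W is therefore controlled by the supremum norm up to
the number of frequencies.
\<close>

lemma wnorm_le_trig_poly:
  assumes S: "finite S" and f: "f \<in> trig_polys S" and M: "\<And>x. norm (f x) \<le> M"
  shows "wnorm_le f (real (card S) * M)"
proof -
  obtain a where a: "f = (\<lambda>x. \<Sum>\<gamma>\<in>S. a \<gamma> * character \<gamma> x)" 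
    using f unfolding trig_polys_def by blast
  have coeff: "norm (a \<delta>) \<le> M" if \<delta>: "\<delta> \<in> S" for \<delta>
  proof (rule constant_coeff_le_sup)
    let ?S = "(\<lambda>\<gamma>. \<gamma> - \<delta>) ` (S - {\<delta>})"
    show "finite ?S" "0 \<notin> ?S" using S by auto
    fix x
    have "a \<delta> + (\<Sum>\<gamma>\<in>?S. a (\<gamma> + \<delta>) * character \<gamma> x) =
          a \<delta> + (\<Sum>\<gamma>\<in>S - {\<delta>}. a \<gamma> * character (\<gamma> - \<delta>) x)"
      by (subst sum.reindex) (auto simp: inj_on_def)
    also have "\<dots> = (\<Sum>\<gamma>\<in>S. a \<gamma> * character (\<gamma> - \<delta>) x)"
      using S \<delta> by (simp add: sum.remove)
    also have "\<dots> = f x * character (- \<delta>) x"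
      unfolding a sum_distrib_right diff_conv_add_uminus character_add by (simp add: mult_ac)
    also have "norm \<dots> \<le> M" using M by (simp add: norm_mult)
    finally show "norm (a \<delta> + (\<Sum>\<gamma>\<in>?S. a (\<gamma> + \<delta>) * character \<gamma> x)) \<le> M" .
  qed
  have "wnorm_le (\<lambda>x. \<Sum>\<gamma>\<in>S. a \<gamma> * character \<gamma> x * 1) (\<Sum>\<gamma>\<in>S. M)"
    by (intro wnorm_le_sum S wnorm_le_mono[OF wnorm_le_scaled_character_times[OF wnorm_le_1]])
       (use coeff in auto)
  thus ?thesis by (simp add: a)
qed

text \<open>
The frequencies of a polynomial of degree n in characters with frequencies in S lie in this set.
It contains more combinations than necessary (each coefficient separately is at most n), which
makes counting trivial: its cardinality grows only polynomially in n, and this is what makes the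
norm in W and the supremum norm of n-th powers agree up to a polynomial factor in n.
\<close>

definition freqs :: "(real ^ 'd) set \<Rightarrow> nat \<Rightarrow> (real ^ 'd) set" where
  "freqs S n = (\<lambda>k. \<Sum>\<gamma>\<in>S. real (k \<gamma>) *\<^sub>R \<gamma>) ` (S \<rightarrow>\<^sub>E {..n})"

lemma freqs_I: 
  assumes "\<And>\<gamma>. \<gamma> \<in> S \<Longrightarrow> k \<gamma> \<le> n" 
  shows "(\<Sum>\<gamma>\<in>S. real (k \<gamma>) *\<^sub>R \<gamma>) \<in> freqs S n"
  unfolding freqs_def by (rule image_eqI[of _ _ "restrict k S"]) (use assms in auto)

lemma finite_freqs: "finite S \<Longrightarrow> finite (freqs S n)"
  by (simp add: freqs_def finite_PiE)

lemma card_freqs: "finite S \<Longrightarrow> card (freqs S n) \<le> (n + 1) ^ card S"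
  unfolding freqs_def
  by (rule order_trans[OF card_image_le]) (auto simp: finite_PiE card_PiE)

lemma zero_in_freqs: "0 \<in> freqs S n"
  using freqs_I[of S "\<lambda>_. 0" n] by simp

lemma freqs_add:
  assumes "\<gamma> \<in> freqs S m" "\<delta> \<in> freqs S n"
  shows "\<gamma> + \<delta> \<in> freqs S (m + n)"
proof -
  obtain k l where k: "k \<in> S \<rightarrow>\<^sub>E {..m}" "l \<in> S \<rightarrow>\<^sub>E {..n}" 
    and e: "\<gamma> = (\<Sum>\<gamma>\<in>S. real (k \<gamma>) *\<^sub>R \<gamma>)" "\<delta> = (\<Sum>\<gamma>\<in>S. real (l \<gamma>) *\<^sub>R \<gamma>)"
    using assms unfolding freqs_def by blast
  have "\<gamma> + \<delta> = (\<Sum>\<gamma>\<in>S. real (k \<gamma> + l \<gamma>) *\<^sub>R \<gamma>)"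
    by (simp add: e sum.distrib algebra_simps)
  also have "\<dots> \<in> freqs S (m + n)"
    using k by (intro freqs_I add_mono) (auto simp: PiE_iff)
  finally show ?thesis .
qed

lemma subset_freqs: 
  assumes "finite S" shows "S \<subseteq> freqs S 1"
proof
  fix \<delta> assume "\<delta> \<in> S"
  hence "\<delta> = (\<Sum>\<gamma>\<in>S. real (if \<gamma> = \<delta> then 1 else 0) *\<^sub>R \<gamma>)"
    using assms by (simp add: if_distrib if_distribR cong: if_cong)
  thus "\<delta> \<in> freqs S 1" using freqs_I[of S "\<lambda>\<gamma>. if \<gamma> = \<delta> then 1 else 0" 1] by simp
qed

lemma trig_polys_freqs_power:
  assumes S: "finite S" and f: "f \<in> trig_polys (freqs S m)"
  shows "(\<lambda>x. f x ^ n) \<in> trig_polys (freqs S (m * n))"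
proof (induction n)
  case 0
  show ?case using S by (simp add: trig_polys_const finite_freqs zero_in_freqs)
next
  case (Suc n)
  have "(\<lambda>x. f x * f x ^ n) \<in> trig_polys (freqs S (m + m * n))"
    using trig_polys_mult[OF f Suc finite_freqs[OF S] freqs_add] .
  thus ?case by simp
qed

lemma wnorm_le_trig_poly_freqs:
  assumes "finite S" "f \<in> trig_polys (freqs S n)" "\<And>x. norm (f x) \<le> M"
  shows "wnorm_le f (real (n + 1) ^ card S * M)"
proof (rule wnorm_le_mono[OF wnorm_le_trig_poly])
  have "M \<ge> 0" using assms(3)[of undefined] norm_ge_zero order_trans by blast
  moreover have "real (card (freqs S n)) \<le> real (n + 1) ^ card S"
    using card_freqs[OF assms(1), of n] by (metis of_nat_le_iff of_nat_power)
  ultimately show "real (card (freqs S n)) * M \<le> real (n + 1) ^ card S * M"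
    by (rule mult_right_mono[rotated])
qed (use assms finite_freqs in auto)

section \<open>Functional calculus for power series\<close>

text \<open>
A finite partial sum of the series is a trigonometric polynomial, and the tail has small norm.
\<close>

lemma class_W_approx:
  assumes "f \<in> class_W" "\<eta> > 0"
  obtains S P where "finite S" "P \<in> trig_polys S" "wnorm_le (\<lambda>x. f x - P x) \<eta>"
proof -
  obtain c \<gamma> where c: "summable (\<lambda>n. norm (c n))"
    "\<And>x. (\<lambda>n::nat. c n * character (\<gamma> n) x) sums f x"
    using assms(1) unfolding class_W_iff wnorm_le_def by blast
  obtain N where N: "norm (\<Sum>n. norm (c (n + N))) < \<eta>"
    using suminf_exist_split[OF assms(2) c(1)] by blast
  show ?thesis
  proof
    show "finite (\<gamma> ` {..<N})" by simp
    show "(\<lambda>x. \<Sum>n<N. c n * character (\<gamma> n) x) \<in> trig_polys (\<gamma> ` {..<N})"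
      by (intro trig_polys_sum trig_polys_character) auto
    show "wnorm_le (\<lambda>x. f x - (\<Sum>n<N. c n * character (\<gamma> n) x)) \<eta>"
      unfolding wnorm_le_def
    proof (intro exI conjI allI)
      show "summable (\<lambda>n. norm (c (n + N)))" using c(1) summable_iff_shift[of "\<lambda>n. norm (c n)" N] by simp
      show "(\<Sum>n. norm (c (n + N))) \<le> \<eta>" using N by simp
      show "(\<lambda>n. c (n + N) * character (\<gamma> (n + N)) x) sums
          (f x - (\<Sum>n<N. c n * character (\<gamma> n) x))" for x
        using c(2)[of x] by (subst sums_iff_shift) simp
    qed
  qed
qed

lemma Bseq_poly_times_geometric:
  fixes r :: real
  assumes "0 \<le> r" "r < 1"
  shows "Bseq (\<lambda>n. real (n + 1) ^ m * r ^ n)"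
  using assms
proof (induction m arbitrary: r)
  case 0
  have "(\<lambda>n. r ^ n) \<longlonglongrightarrow> 0" using 0 by (intro LIMSEQ_power_zero) auto
  thus ?case by (auto intro: convergent_imp_Bseq convergentI)
next
  case (Suc m)
  \<comment> \<open>Each factor of degree one is paid for with half of the geometric decay.\<close>
  define q where "q = sqrt r"
  have q: "0 \<le> q" "q < 1" "r = q * q" using Suc.prems by (auto simp: q_def)
  have "(\<lambda>n. real n * q ^ n + q ^ n) \<longlonglongrightarrow> 0 + 0"
    using q by (intro tendsto_add powser_times_n_limit_0 LIMSEQ_power_zero) auto
  hence "Bseq (\<lambda>n. real n * q ^ n + q ^ n)" by (intro convergent_imp_Bseq convergentI)
  from Bseq_mult[OF this Suc.IH[OF q(1,2)]] show ?case
    by (simp add: q(3) power_mult_distrib algebra_simps)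
qed

text \<open>
The spectral radius of u in W is at most its supremum norm. For a trigonometric polynomial P the
powers have polynomially many frequencies, so their norm is at most a polynomial in n times the
n-th power of the supremum of P. A general u is P plus a remainder of norm \<eta>, and the binomial
theorem shows that the remainder costs only \<eta> in the base of the exponential growth; another
\<eta> is lost because the supremum of P may exceed that of u.
\<close>

lemma wnorm_le_power_growth:
  assumes u: "u \<in> class_W" and bd: "\<And>x. norm (u x) \<le> s" and t: "s < t"
  obtains m where "\<And>n. wnorm_le (\<lambda>x. u x ^ n) (real (n + 1) ^ m * t ^ n)"
proof -
  define \<eta> where "\<eta> = (t - s) / 2"
  have \<eta>: "\<eta> > 0" "s + 2 * \<eta> = t" using t by (auto simp: \<eta>_def field_simps)
  obtain S P where S: "finite S" and P: "P \<in> trig_polys S"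
    and r: "wnorm_le (\<lambda>x. u x - P x) \<eta>"
    using class_W_approx[OF u \<eta>(1)] .
  have s0: "s \<ge> 0" using bd[of undefined] norm_ge_zero order_trans by blast
  have Pbd: "norm (P x) \<le> s + \<eta>" for x
    using norm_triangle_ineq4[of "u x" "u x - P x"] bd[of x] wnorm_le_bound[OF r, of x] by simp
  have Pk: "wnorm_le (\<lambda>x. P x ^ k) (real (k + 1) ^ card S * (s + \<eta>) ^ k)" for k
  proof (rule wnorm_le_trig_poly_freqs[OF S])
    have "P \<in> trig_polys (freqs S 1)"
      using P subset_freqs[OF S] finite_freqs[OF S] by (rule trig_polys_mono)
    from trig_polys_freqs_power[OF S this, of k] show "(\<lambda>x. P x ^ k) \<in> trig_polys (freqs S k)"
      by simp
    show "norm (P x ^ k) \<le> (s + \<eta>) ^ k" for x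
      using Pbd by (simp add: norm_power power_mono)
  qed
  show ?thesis
  proof
    fix n
    let ?B = "\<lambda>k. real (n choose k) * (real (k + 1) ^ card S * (s + \<eta>) ^ k * \<eta> ^ (n - k))"
    have "wnorm_le (\<lambda>x. \<Sum>k\<le>n. of_nat (n choose k) * (P x ^ k * (u x - P x) ^ (n - k)))
        (\<Sum>k\<le>n. norm (of_nat (n choose k) :: complex) *
          (real (k + 1) ^ card S * (s + \<eta>) ^ k * \<eta> ^ (n - k)))"
      by (intro wnorm_le_sum wnorm_le_cmult wnorm_le_mult wnorm_le_power Pk r) auto
    moreover have "(\<Sum>k\<le>n. of_nat (n choose k) * (P x ^ k * (u x - P x) ^ (n - k))) = u x ^ n" for x
      using binomial_ring[of "P x" "u x - P x" n] by (simp add: mult_ac)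
    ultimately have "wnorm_le (\<lambda>x. u x ^ n) (\<Sum>k\<le>n. ?B k)"
      by simp
    moreover have "(\<Sum>k\<le>n. ?B k) \<le> real (n + 1) ^ card S * t ^ n"
    proof -
      have "(\<Sum>k\<le>n. ?B k) \<le>
          (\<Sum>k\<le>n. real (n choose k) * (real (n + 1) ^ card S * (s + \<eta>) ^ k * \<eta> ^ (n - k)))"
        using s0 \<eta>(1) by (intro sum_mono mult_left_mono mult_right_mono power_mono) auto
      also have "\<dots> = real (n + 1) ^ card S *
          (\<Sum>k\<le>n. real (n choose k) * (s + \<eta>) ^ k * \<eta> ^ (n - k))"
        unfolding sum_distrib_left by (simp only: mult_ac)
      also have "(\<Sum>k\<le>n. real (n choose k) * (s + \<eta>) ^ k * \<eta> ^ (n - k)) = (s + \<eta> + \<eta>) ^ n"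
        by (rule binomial_ring[symmetric])
      also have "s + \<eta> + \<eta> = t" using \<eta>(2) by simp
      finally show ?thesis .
    qed
    ultimately show "wnorm_le (\<lambda>x. u x ^ n) (real (n + 1) ^ card S * t ^ n)"
      by (rule wnorm_le_mono)
  qed
qed

text \<open>
In a Banach algebra a power series can be applied to every element whose spectral radius is
smaller than the radius of convergence. Here the supremum norm takes the place of the spectral
radius.
\<close>

lemma class_W_power_series:
  assumes u: "u \<in> class_W" and bd: "\<And>x. norm (u x) \<le> s" and "s < t"
    and a: "summable (\<lambda>n. norm (a n) * t ^ n)"
  shows "(\<lambda>x. \<Sum>n. a n * u x ^ n) \<in> class_W"
proof -
  have s0: "s \<ge> 0" using bd[of undefined] norm_ge_zero order_trans by blast
  define s' where "s' = (s + t) / 2"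
  have s': "s < s'" "s' < t" using \<open>s < t\<close> by (auto simp: s'_def)
  obtain m where m: "\<And>n. wnorm_le (\<lambda>x. u x ^ n) (real (n + 1) ^ m * s' ^ n)"
    using wnorm_le_power_growth[OF u bd s'(1)] by blast
  have "Bseq (\<lambda>n. real (n + 1) ^ m * (s' / t) ^ n)"
    using s0 s' by (intro Bseq_poly_times_geometric) auto
  then obtain C where C: "\<And>n. norm (real (n + 1) ^ m * (s' / t) ^ n) \<le> C"
    unfolding Bseq_def by blast
  have "summable (\<lambda>n. norm (a n) * (real (n + 1) ^ m * s' ^ n))"
  proof (rule summable_comparison_test')
    show "summable (\<lambda>n. C * (norm (a n) * t ^ n))" using a by (rule summable_mult)
    fix n
    have "norm (a n) * (real (n + 1) ^ m * s' ^ n) =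
        (real (n + 1) ^ m * (s' / t) ^ n) * (norm (a n) * t ^ n)"
      using s0 s' by (simp add: power_divide)
    also have "\<dots> \<le> C * (norm (a n) * t ^ n)"
      using C[of n] s0 s' by (intro mult_right_mono) auto
    finally show "norm (norm (a n) * (real (n + 1) ^ m * s' ^ n)) \<le> C * (norm (a n) * t ^ n)"
      using s0 s' by (simp add: abs_mult)
  qed
  hence "wnorm_le (\<lambda>x. \<Sum>n. a n * u x ^ n) (\<Sum>n. norm (a n) * (real (n + 1) ^ m * s' ^ n))"
    by (intro wnorm_le_suminf wnorm_le_cmult m)
  thus ?thesis by (rule class_W_I)
qed

text \<open>
Wiener's lemma for positive functions, from the geometric series in 1 - F/B, where B is an
upper bound of F.
\<close>

lemma class_W_reciprocal:
  assumes F: "(\<lambda>x. complex_of_real (F x)) \<in> class_W" and "0 < c" and c: "\<And>x. c \<le> F x"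
  shows "(\<lambda>x. complex_of_real (1 / F x)) \<in> class_W"
proof -
  obtain B where B: "wnorm_le (\<lambda>x. complex_of_real (F x)) B" using F class_W_iff by blast
  have FB: "F x \<le> B" for x using wnorm_le_bound[OF B, of x] by simp
  have B0: "0 < B" "c \<le> B" using c FB \<open>0 < c\<close> by (meson order_trans less_le_trans)+
  define u where "u = (\<lambda>x. complex_of_real (1 - F x / B))"
  have sums: "(\<lambda>n. u x ^ n) sums of_real (B / F x)" for x
  proof -
    have "norm (u x) < 1" unfolding u_def norm_of_real
      using FB[of x] c[of x] \<open>0 < c\<close> B0 by (auto simp: field_simps abs_if)
    from geometric_sums[OF this] show ?thesis by (simp add: u_def)
  qed
  have "(\<lambda>x. \<Sum>n. 1 * u x ^ n) \<in> class_W"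
  proof (rule class_W_power_series)
    have "(\<lambda>x. 1 - of_real (1/B) * complex_of_real (F x)) \<in> class_W"
      by (intro class_W_diff class_W_1 class_W_cmult F)
    thus "u \<in> class_W" by (simp add: u_def)
    show "norm (u x) \<le> 1 - c / B" for x unfolding u_def norm_of_real
      using FB[of x] c[of x] \<open>0 < c\<close> B0 by (auto simp: field_simps abs_if)
    show "1 - c / B < 1 - c / (2 * B)" using \<open>0 < c\<close> B0 by (simp add: field_simps)
    show "summable (\<lambda>n. norm (1::complex) * (1 - c / (2 * B)) ^ n)"
    proof -
      have "norm (1 - c / (2 * B)) < 1" using \<open>0 < c\<close> B0 by (auto simp: field_simps abs_if)
      from summable_geometric[OF this] show ?thesis by simp
    qed
  qed
  hence "(\<lambda>x. of_real (1 / B) * (\<Sum>n. 1 * u x ^ n)) \<in> class_W" by (rule class_W_cmult)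
  also have "(\<lambda>x. of_real (1 / B) * (\<Sum>n. 1 * u x ^ n)) = (\<lambda>x. complex_of_real (1 / F x))"
    using B0 sums_unique[OF sums] by (simp add: fun_eq_iff field_simps)
  finally show ?thesis .
qed

section \<open>Cutoff functions\<close>

lemma gbinomial_bound:
  fixes z :: real
  obtains C where "\<And>n. n \<ge> 1 \<Longrightarrow> \<bar>z gchoose n\<bar> \<le> C * real n powr (- z - 1)"
proof -
  have "Bseq (\<lambda>n. (z gchoose n) / ((-1)^n / exp ((z+1) * of_real (ln (real n)))))"
    using gbinomial_asymptotic[of z] by (intro convergent_imp_Bseq convergentI)
  then obtain C where C: "\<And>n. norm ((z gchoose n) / ((-1)^n / exp ((z+1) * of_real (ln (real n))))) \<le> C"
    unfolding Bseq_def by blast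
  show ?thesis
  proof
    fix n :: nat assume n: "n \<ge> 1"
    have "real n powr (z + 1) = exp ((z+1) * of_real (ln (real n)))"
      using n by (simp add: powr_def)
    hence "\<bar>z gchoose n\<bar> * real n powr (z + 1) \<le> C" 
      using C[of n] by (simp add: abs_mult power_abs)
    moreover have "real n powr (z + 1) * real n powr (- z - 1) = 1"
      using n by (simp flip: powr_add)
    ultimately show "\<bar>z gchoose n\<bar> \<le> C * real n powr (- z - 1)"
      using mult_right_mono[of "\<bar>z gchoose n\<bar> * real n powr (z + 1)" C "real n powr (- z - 1)"]
      by (simp add: mult.assoc)
  qed
qed

text \<open>
The source of functions that are not analytic: odd powers of the absolute value are obtained by
putting y = 1 - t^2 into the binomial series of (1 - y)^(d + 1/2). Its coefficients
are of order j^(-d - 3/2), so the exponent d + 1/2 is large enough for them to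
stay summable against the weight (2 j + 1)^d. The value t = 0 lies on the boundary of the
disc of convergence.
\<close>

lemma abs_odd_power_series:
  obtains a :: "nat \<Rightarrow> real" where "summable (\<lambda>j. \<bar>a j\<bar> * real (2 * j + 1) ^ d)"
    "\<And>t. \<bar>t\<bar> \<le> 1 \<Longrightarrow> (\<lambda>j. a j * (1 - t\<^sup>2) ^ j) sums (\<bar>t\<bar> ^ (2 * d + 1))"
proof -
  define \<alpha> where "\<alpha> = real d + 1/2"
  define a where "a = (\<lambda>j. (\<alpha> gchoose j) * (-1) ^ j)"
  obtain C where C: "\<And>n. n \<ge> 1 \<Longrightarrow> \<bar>\<alpha> gchoose n\<bar> \<le> C * real n powr (- \<alpha> - 1)"
    using gbinomial_bound by blast
  have C0: "C \<ge> 0" using C[of 1] by simp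
  have sm: "summable (\<lambda>j. \<bar>a j\<bar> * real (2 * j + 1) ^ d)"
  proof (rule summable_comparison_test')
    show "summable (\<lambda>j. C * 3 ^ d * real j powr (- 3/2))"
      by (intro summable_mult) (simp add: summable_real_powr_iff)
    fix j :: nat assume j: "1 \<le> j"
    have "\<bar>a j\<bar> * real (2 * j + 1) ^ d \<le> (C * real j powr (- \<alpha> - 1)) * (3 * real j) ^ d"
      using C[OF j] j C0 by (intro mult_mono power_mono) (auto simp: a_def abs_mult power_abs)
    also have "(3 * real j) ^ d = 3 ^ d * real j powr real d"
      using j by (simp add: power_mult_distrib powr_realpow)
    also have "(C * real j powr (- \<alpha> - 1)) * (3 ^ d * real j powr real d) =
        C * 3 ^ d * real j powr (- 3/2)"
      by (simp add: \<alpha>_def mult_ac flip: powr_add)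
    finally show "norm (\<bar>a j\<bar> * real (2 * j + 1) ^ d) \<le> C * 3 ^ d * real j powr (- 3/2)"
      by simp
  qed
  have "(\<lambda>j. a j * (1 - t\<^sup>2) ^ j) sums (\<bar>t\<bar> ^ (2 * d + 1))" if t: "\<bar>t\<bar> \<le> 1" for t
  proof (cases "t = 0")
    case False
    have "t\<^sup>2 \<le> 1" "t\<^sup>2 > 0" using t False by (auto simp: abs_square_le_1)
    hence "\<bar>t\<^sup>2 - 1\<bar> < 1" by auto
    from gen_binomial_real[OF this, of \<alpha>]
    have "(\<lambda>j. (\<alpha> gchoose j) * (t\<^sup>2 - 1) ^ j) sums ((t\<^sup>2) powr \<alpha>)" by simp
    moreover have "(t\<^sup>2 - 1) ^ j = (-1) ^ j * (1 - t\<^sup>2) ^ j" for j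
      by (simp flip: power_mult_distrib)
    moreover have "(t\<^sup>2) powr \<alpha> = \<bar>t\<bar> ^ (2 * d + 1)"
    proof -
      have "t\<^sup>2 = \<bar>t\<bar> powr 2" using False by simp
      hence "(t\<^sup>2) powr \<alpha> = (\<bar>t\<bar> powr 2) powr \<alpha>" by (rule arg_cong)
      also have "\<dots> = \<bar>t\<bar> powr real (2 * d + 1)"
        unfolding powr_powr by (simp add: \<alpha>_def algebra_simps)
      also have "\<dots> = \<bar>t\<bar> ^ (2 * d + 1)" using False by (subst powr_realpow) auto
      finally show ?thesis .
    qed
    ultimately show ?thesis by (simp add: a_def mult_ac)
  next
    case True
    \<comment> \<open>The partial sums are, up to sign, binomial coefficients for \<alpha> - 1, which tend to 0.\<close>
    obtain C' where C': "\<And>n. n \<ge> 1 \<Longrightarrow> \<bar>\<alpha> - 1 gchoose n\<bar> \<le> C' * real n powr (- (\<alpha> - 1) - 1)"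
      using gbinomial_bound by blast
    have "(\<lambda>n. real n powr (- \<alpha>)) \<longlonglongrightarrow> 0"
      by (intro tendsto_neg_powr filterlim_real_sequentially) (simp add: \<alpha>_def)
    from tendsto_mult_right_zero[OF this, of C'] 
    have "(\<lambda>n. (-1) ^ n * (\<alpha> - 1 gchoose n)) \<longlonglongrightarrow> 0"
      by (rule Lim_null_comparison[rotated])
         (use C' in \<open>auto intro!: eventually_sequentiallyI[of 1] simp: abs_mult power_abs\<close>)
    hence "(\<lambda>n. \<Sum>j\<le>n. a j) \<longlonglongrightarrow> 0"
      by (simp add: a_def gbinomial_sum_lower_neg)
    hence "a sums 0" by (simp add: sums_def_le)
    thus ?thesis using True by simp
  qed
  thus ?thesis using sm that by blast
qed

text \<open>
The function (1 - q^2)^j is a trigonometric polynomial with values in [0, 1] whose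
frequencies number at most (2 j + 1)^card S. Its norm is at most that number, and so the
series of the preceding lemma converges in W. The exponent has to grow with the number of
frequencies: a fixed amount of smoothness does not suffice on tori of all dimensions.
\<close>

lemma class_W_pos_part_power:
  fixes q :: "real ^ 'd \<Rightarrow> real"
  assumes S: "finite S" and q: "(\<lambda>x. complex_of_real (q x)) \<in> trig_polys S" 
    and bd: "\<And>x. \<bar>q x\<bar> \<le> 1"
  shows "(\<lambda>x. complex_of_real (max 0 (q x) ^ (2 * card S + 1))) \<in> class_W"
proof -
  define N where "N = 2 * card S + 1"
  obtain a :: "nat \<Rightarrow> real" where a: "summable (\<lambda>j. \<bar>a j\<bar> * real (2 * j + 1) ^ card S)"
    "\<And>t. \<bar>t\<bar> \<le> 1 \<Longrightarrow> (\<lambda>j. a j * (1 - t\<^sup>2) ^ j) sums (\<bar>t\<bar> ^ N)"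
    using abs_odd_power_series[of "card S"] unfolding N_def by blast
  have q1: "(\<lambda>x. complex_of_real (q x)) \<in> trig_polys (freqs S 1)"
    using q subset_freqs[OF S] finite_freqs[OF S] by (rule trig_polys_mono)
  have "(\<lambda>x. 1 + (-1) * complex_of_real (q x) ^ 2) \<in> trig_polys (freqs S 2)"
    using trig_polys_freqs_power[OF S q1, of 2] finite_freqs[OF S] zero_in_freqs
    by (intro trig_polys_add trig_polys_const trig_polys_cmult) auto
  hence q2: "(\<lambda>x. complex_of_real (1 - (q x)\<^sup>2)) \<in> trig_polys (freqs S 2)" by simp
  have "wnorm_le (\<lambda>x. complex_of_real (1 - (q x)\<^sup>2) ^ j) (real (2 * j + 1) ^ card S * 1)" for j
  proof (rule wnorm_le_trig_poly_freqs[OF S trig_polys_freqs_power[OF S q2]])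
    fix x
    have "(q x)\<^sup>2 \<le> 1" "0 \<le> (q x)\<^sup>2" using bd[of x] by (auto simp: abs_square_le_1)
    thus "norm (complex_of_real (1 - (q x)\<^sup>2) ^ j) \<le> 1"
      unfolding norm_power norm_of_real by (intro power_le_one) auto
  qed
  hence "wnorm_le (\<lambda>x. of_real (a j) * complex_of_real (1 - (q x)\<^sup>2) ^ j)
      (\<bar>a j\<bar> * real (2 * j + 1) ^ card S)" for j
    using wnorm_le_cmult[of "\<lambda>x. complex_of_real (1 - (q x)\<^sup>2) ^ j" _ "of_real (a j)"] by fastforce
  from wnorm_le_suminf[OF this a(1)] 
  have "(\<lambda>x. \<Sum>j. of_real (a j) * complex_of_real (1 - (q x)\<^sup>2) ^ j) \<in> class_W"
    by (rule class_W_I)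
  moreover have "(\<Sum>j. of_real (a j) * complex_of_real (1 - (q x)\<^sup>2) ^ j) = of_real (\<bar>q x\<bar> ^ N)" for x
    using sums_unique[OF sums_of_real[OF a(2)[OF bd[of x]], where 'a = complex]] by simp
  ultimately have "(\<lambda>x. complex_of_real (\<bar>q x\<bar> ^ N)) \<in> class_W" by simp
  moreover have "(\<lambda>x. complex_of_real (q x) ^ N) \<in> class_W"
    using class_W_I[OF wnorm_le_power[OF wnorm_le_trig_poly[OF S q, of 1], of N]] bd by simp
  ultimately have "(\<lambda>x. of_real (1/2) * (complex_of_real (\<bar>q x\<bar> ^ N) + complex_of_real (q x) ^ N)) \<in> class_W"
    by (intro class_W_cmult class_W_add)
  also have "(\<lambda>x. of_real (1/2) * (complex_of_real (\<bar>q x\<bar> ^ N) + complex_of_real (q x) ^ N)) =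
      (\<lambda>x. complex_of_real (max 0 (q x) ^ N))"
  proof
    fix x
    have "odd N" by (simp add: N_def)
    hence e: "max 0 (q x) ^ N = 1/2 * (\<bar>q x\<bar> ^ N + q x ^ N)"
      by (cases "q x \<ge> 0") (auto simp: max_def abs_if power_minus_odd N_def)
    show "of_real (1/2) * (complex_of_real (\<bar>q x\<bar> ^ N) + complex_of_real (q x) ^ N) =
      complex_of_real (max 0 (q x) ^ N)" unfolding e by simp
  qed
  finally show ?thesis by (simp add: N_def)
qed

text \<open>
With A a power of the positive part of b - p and B the same power of the positive part of
p - a, the quotient A / (A + B) is a cutoff. At each point p stays away from a or from b, so the
denominator is bounded below and Wiener's lemma applies. The cutoff exists for polynomials p; for a
general element of W in their place the norms of (1 - q^2)^j may grow too fast.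
\<close>

lemma class_W_cutoff:
  fixes p :: "real ^ 'd \<Rightarrow> real"
  assumes S: "finite S" and p: "(\<lambda>x. complex_of_real (p x)) \<in> trig_polys S" and "a < b"
  obtains \<psi> where "(\<lambda>x. complex_of_real (\<psi> x)) \<in> class_W" "\<And>x. 0 \<le> \<psi> x" "\<And>x. \<psi> x \<le> 1"
    "\<And>x. p x \<le> a \<Longrightarrow> \<psi> x = 1" "\<And>x. b \<le> p x \<Longrightarrow> \<psi> x = 0"
proof -
  define S' where "S' = insert 0 S"
  have S': "finite S'" "0 \<in> S'" using S by (auto simp: S'_def)
  have p': "(\<lambda>x. complex_of_real (p x)) \<in> trig_polys S'"
    using p by (rule trig_polys_mono) (use S' in \<open>auto simp: S'_def\<close>)
  obtain M where M: "\<And>x. \<bar>p x\<bar> \<le> M"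
  proof -
    obtain c where c: "(\<lambda>x. complex_of_real (p x)) = (\<lambda>x. \<Sum>\<gamma>\<in>S. c \<gamma> * character \<gamma> x)"
      using p unfolding trig_polys_def by blast
    have "\<bar>p x\<bar> \<le> (\<Sum>\<gamma>\<in>S. norm (c \<gamma>))" for x
    proof -
      have "\<bar>p x\<bar> = norm (\<Sum>\<gamma>\<in>S. c \<gamma> * character \<gamma> x)"
        using fun_cong[OF c, of x] norm_of_real by metis
      also have "\<dots> \<le> (\<Sum>\<gamma>\<in>S. norm (c \<gamma>))"
        by (rule sum_norm_le) (simp add: norm_mult)
      finally show ?thesis .
    qed
    thus ?thesis using that by blast
  qed
  \<comment> \<open>Dividing by L brings both b - p and p - a into [-1, 1].\<close>
  define L where "L = M + \<bar>a\<bar> + \<bar>b\<bar> + 1"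
  have L: "L > 0" using M[of undefined] by (simp add: L_def)
  define N where "N = 2 * card S' + 1"
  define A where "A = (\<lambda>x. max 0 ((b - p x) / L) ^ N)"
  define B where "B = (\<lambda>x. max 0 ((p x - a) / L) ^ N)"
  have A: "(\<lambda>x. complex_of_real (A x)) \<in> class_W" unfolding A_def N_def
  proof (rule class_W_pos_part_power[OF S'(1)])
    have "(\<lambda>x. of_real (b / L) + of_real (- 1 / L) * complex_of_real (p x)) \<in> trig_polys S'"
      using S' p' by (intro trig_polys_add trig_polys_const trig_polys_cmult)
    thus "(\<lambda>x. complex_of_real ((b - p x) / L)) \<in> trig_polys S'"
      by (simp add: diff_divide_distrib)
    show "\<bar>(b - p x) / L\<bar> \<le> 1" for x
      using L M[of x] by (simp add: L_def)
  qed
  have B: "(\<lambda>x. complex_of_real (B x)) \<in> class_W" unfolding B_def N_def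
  proof (rule class_W_pos_part_power[OF S'(1)])
    have "(\<lambda>x. of_real (- a / L) + of_real (1 / L) * complex_of_real (p x)) \<in> trig_polys S'"
      using S' p' by (intro trig_polys_add trig_polys_const trig_polys_cmult)
    thus "(\<lambda>x. complex_of_real ((p x - a) / L)) \<in> trig_polys S'"
      by (simp add: diff_divide_distrib)
    show "\<bar>(p x - a) / L\<bar> \<le> 1" for x
      using L M[of x] by (simp add: L_def)
  qed
  have nonneg: "A x \<ge> 0" "B x \<ge> 0" for x by (auto simp: A_def B_def)
  define m where "m = ((b - a) / (2 * L)) ^ N"
  have m: "m > 0" using \<open>a < b\<close> L by (simp add: m_def)
  have lower: "m \<le> A x + B x" for x
  proof (cases "p x \<le> (a + b) / 2")
    case True
    have "(b - a) / 2 / L \<le> (b - p x) / L"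
      using True L by (intro divide_right_mono) auto
    hence "(b - a) / (2 * L) \<le> max 0 ((b - p x) / L)" by simp
    hence "m \<le> A x" unfolding m_def A_def using \<open>a < b\<close> L by (intro power_mono) auto
    thus ?thesis using nonneg(2)[of x] by linarith
  next
    case False
    have "(b - a) / 2 / L \<le> (p x - a) / L"
      using False L by (intro divide_right_mono) auto
    hence "(b - a) / (2 * L) \<le> max 0 ((p x - a) / L)" by simp
    hence "m \<le> B x" unfolding m_def B_def using \<open>a < b\<close> L by (intro power_mono) auto
    thus ?thesis using nonneg(1)[of x] by linarith
  qed
  have pos: "A x + B x > 0" for x using lower[of x] m by linarith
  show ?thesis
  proof
    have "(\<lambda>x. complex_of_real (1 / (A x + B x))) \<in> class_W"
      using class_W_add[OF A B] m lower by (intro class_W_reciprocal[of _ m]) simp_all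
    from class_W_mult[OF A this]
    show "(\<lambda>x. complex_of_real (A x / (A x + B x))) \<in> class_W" by simp
    fix x
    show "0 \<le> A x / (A x + B x)" using nonneg pos by (simp add: less_imp_le)
    show "A x / (A x + B x) \<le> 1" using nonneg(2)[of x] pos[of x] by simp
    show "A x / (A x + B x) = 1" if "p x \<le> a"
    proof -
      have "(p x - a) / L \<le> 0" using that L by (simp add: divide_le_0_iff)
      hence "B x = 0" by (simp add: B_def N_def)
      thus ?thesis using pos[of x] by simp
    qed
    show "A x / (A x + B x) = 0" if "b \<le> p x"
    proof -
      have "(b - p x) / L \<le> 0" using that L by (simp add: divide_le_0_iff)
      thus ?thesis by (simp add: A_def N_def)
    qed
  qed
qed

text \<open>
The squared distance of P from z is a real-valued trigonometric polynomial, because the class of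
trigonometric polynomials is closed under products and complex conjugation.
\<close>

lemma class_W_disc_cutoff:
  assumes S: "finite S" and P: "P \<in> trig_polys S" and "0 < r" "r < r'"
  obtains \<psi> where "(\<lambda>x. complex_of_real (\<psi> x)) \<in> class_W" "\<And>x. 0 \<le> \<psi> x" "\<And>x. \<psi> x \<le> 1"
    "\<And>x. norm (P x - z) \<le> r \<Longrightarrow> \<psi> x = 1" "\<And>x. r' \<le> norm (P x - z) \<Longrightarrow> \<psi> x = 0"
proof -
  define S0 where "S0 = insert 0 S"
  have S0: "finite S0" "0 \<in> S0" using S by (auto simp: S0_def)
  define S1 where "S1 = (\<lambda>(\<gamma>, \<delta>). \<gamma> + \<delta>) ` (S0 \<times> uminus ` S0)"
  have S1: "finite S1" using S0 by (simp add: S1_def)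
  have "P \<in> trig_polys S0" using P by (rule trig_polys_mono) (use S0 in \<open>auto simp: S0_def\<close>)
  hence "(\<lambda>x. P x + (- z)) \<in> trig_polys S0" using S0 by (intro trig_polys_add trig_polys_const)
  hence Pz: "(\<lambda>x. P x - z) \<in> trig_polys S0" by simp
  have "(\<lambda>x. (P x - z) * cnj (P x - z)) \<in> trig_polys S1"
    by (rule trig_polys_mult[OF Pz trig_polys_cnj[OF Pz S0(1)] S1]) (auto simp: S1_def)
  hence p: "(\<lambda>x. complex_of_real ((norm (P x - z))\<^sup>2)) \<in> trig_polys S1"
    by (simp only: complex_norm_square)
  have "r\<^sup>2 < r'\<^sup>2" using assms(3,4) by (intro power_strict_mono) auto
  from class_W_cutoff[OF S1 p this] obtain \<psi> where \<psi>:
    "(\<lambda>x. complex_of_real (\<psi> x)) \<in> class_W" "\<And>x. 0 \<le> \<psi> x" "\<And>x. \<psi> x \<le> 1"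
    "\<And>x. (norm (P x - z))\<^sup>2 \<le> r\<^sup>2 \<Longrightarrow> \<psi> x = 1" "\<And>x. r'\<^sup>2 \<le> (norm (P x - z))\<^sup>2 \<Longrightarrow> \<psi> x = 0"
    by blast
  show ?thesis
    by (rule that[of \<psi>]) (use \<psi> assms(3,4) in \<open>auto intro: power_mono\<close>)
qed

section \<open>Holomorphic functions of an element of the class\<close>

text \<open>
On a disc h is a power series, but f - z may leave the disc of convergence. Multiplying it by a
cutoff gives w, which agrees with f - z where P is within 3 \<rho> of z and has modulus at most
5 \<rho> everywhere: the cutoff vanishes where P is further than 4 \<rho> from z, and f differs
from P by at most \<rho>. The power series of h can then be applied to w.
\<close>

lemma class_W_compose_local:
  assumes f: "f \<in> class_W" and S: "finite S" and P: "P \<in> trig_polys S"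
    and near: "\<And>x. norm (f x - P x) \<le> \<rho>" and "0 < \<rho>" and h: "h holomorphic_on ball z (6 * \<rho>)"
  obtains g where "g \<in> class_W" "\<And>x. norm (P x - z) \<le> 3 * \<rho> \<Longrightarrow> g x = h (f x)"
proof -
  obtain \<psi> where \<psi>: "(\<lambda>x. complex_of_real (\<psi> x)) \<in> class_W" "\<And>x. 0 \<le> \<psi> x" "\<And>x. \<psi> x \<le> 1"
    "\<And>x. norm (P x - z) \<le> 3 * \<rho> \<Longrightarrow> \<psi> x = 1" "\<And>x. 4 * \<rho> \<le> norm (P x - z) \<Longrightarrow> \<psi> x = 0"
    using class_W_disc_cutoff[OF S P, of "3 * \<rho>" "4 * \<rho>" z] \<open>0 < \<rho>\<close> by auto
  define w where "w = (\<lambda>x. of_real (\<psi> x) * (f x - z))"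
  define a where "a = (\<lambda>n. (deriv ^^ n) h z / fact n)"
  have a: "(\<lambda>n. a n * (y - z) ^ n) sums h y" if "norm (y - z) < 6 * \<rho>" for y
    unfolding a_def using that by (intro holomorphic_power_series[OF h]) (simp add: dist_norm norm_minus_commute)
  have fz: "norm (f x - z) \<le> \<rho> + norm (P x - z)" for x
    using norm_triangle_ineq[of "f x - P x" "P x - z"] near[of x] by simp
  show ?thesis
  proof
    \<comment> \<open>Radii between 5 and 6 times \<rho>: 11/2 for absolute convergence, 23/4 for convergence.\<close>
    show "(\<lambda>x. \<Sum>n. a n * w x ^ n) \<in> class_W"
    proof (rule class_W_power_series)
      show "w \<in> class_W" unfolding w_def by (intro class_W_mult \<psi> class_W_diff f class_W_const)
      show "norm (w x) \<le> 5 * \<rho>" for x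
      proof (cases "4 * \<rho> \<le> norm (P x - z)")
        case True
        thus ?thesis using \<psi>(5) \<open>0 < \<rho>\<close> by (simp add: w_def)
      next
        case False
        have "norm (w x) \<le> 1 * norm (f x - z)"
          unfolding w_def norm_mult using \<psi>(2,3) by (intro mult_right_mono) auto
        thus ?thesis using fz[of x] False by simp
      qed
      show "5 * \<rho> < 11/2 * \<rho>" using \<open>0 < \<rho>\<close> by simp
      have "summable (\<lambda>n. a n * (of_real (23/4 * \<rho>)) ^ n)"
        using sums_summable[OF a[of "z + of_real (23/4 * \<rho>)"]] \<open>0 < \<rho>\<close> by (simp add: norm_mult)
      from powser_insidea[OF this, of "of_real (11/2 * \<rho>)"] 
      show "summable (\<lambda>n. norm (a n) * (11/2 * \<rho>) ^ n)"
        using \<open>0 < \<rho>\<close> by (simp add: norm_mult norm_power power_mult_distrib)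
    qed
    fix x assume x: "norm (P x - z) \<le> 3 * \<rho>"
    hence "norm (f x - z) < 6 * \<rho>" using fz[of x] \<open>0 < \<rho>\<close> by linarith
    from sums_unique[OF a[OF this]] show "(\<Sum>n. a n * w x ^ n) = h (f x)"
      using \<psi>(4)[OF x] by (simp add: w_def)
  qed
qed

theorem theorem7:
  fixes K U :: "complex set" and h :: "complex \<Rightarrow> complex" and f :: "real ^ 'd \<Rightarrow> complex"
  assumes "compact K"
    and "open U" and "K \<subseteq> U" and "h holomorphic_on U"
    and "f \<in> class_W"
  shows "\<exists>g \<in> class_W. \<forall>x. f x \<in> K \<longrightarrow> g x = h (f x)"
proof -
  \<comment> \<open>Six steps of length \<rho> leave room for the nested radii of the local construction.\<close>
  obtain \<epsilon> where \<epsilon>: "\<epsilon> > 0" "(\<Union>z\<in>K. ball z \<epsilon>) \<subseteq> U"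
    using compact_subset_open_imp_ball_epsilon_subset[OF assms(1-3)] .
  define \<rho> where "\<rho> = \<epsilon> / 6"
  have \<rho>: "\<rho> > 0" "\<epsilon> = 6 * \<rho>" using \<epsilon> by (auto simp: \<rho>_def)
  obtain S P where S: "finite S" and P: "P \<in> trig_polys S" and r: "wnorm_le (\<lambda>x. f x - P x) \<rho>"
    using class_W_approx[OF \<open>f \<in> class_W\<close> \<rho>(1)] .
  have near: "norm (f x - P x) \<le> \<rho>" for x using wnorm_le_bound[OF r] .
  obtain Z where Z: "finite Z" "Z \<subseteq> K" "K \<subseteq> (\<Union>z\<in>Z. ball z \<rho>)"
    using compactE_image[OF \<open>compact K\<close>, of K "\<lambda>z. ball z \<rho>"] \<rho>(1)
    by (metis UN_I centre_in_ball open_ball subsetI)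
  \<comment> \<open>Discs of radius 2 \<rho> about the centres, because P is only \<rho>-close to f.\<close>
  have "\<exists>g\<in>class_W. \<forall>x. (\<exists>z\<in>Z. norm (P x - z) \<le> 2 * \<rho>) \<longrightarrow> g x = h (f x)"
    using Z(1,2)
  proof (induction Z rule: finite_induct)
    case empty
    show ?case using class_W_0 by auto
  next
    case (insert z Z)
    obtain g where g: "g \<in> class_W" "\<And>x y. y \<in> Z \<Longrightarrow> norm (P x - y) \<le> 2 * \<rho> \<Longrightarrow> g x = h (f x)"
      using insert by blast
    have "h holomorphic_on ball z (6 * \<rho>)"
      using \<open>h holomorphic_on U\<close> by (rule holomorphic_on_subset) (use insert.prems \<epsilon> \<rho> in blast)
    then obtain k where k: "k \<in> class_W" "\<And>x. norm (P x - z) \<le> 3 * \<rho> \<Longrightarrow> k x = h (f x)"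
      using class_W_compose_local[OF \<open>f \<in> class_W\<close> S P near \<rho>(1)] by blast
    obtain \<psi> where \<psi>: "(\<lambda>x. complex_of_real (\<psi> x)) \<in> class_W"
      "\<And>x. 0 \<le> \<psi> x" "\<And>x. \<psi> x \<le> 1"
      "\<And>x. norm (P x - z) \<le> 2 * \<rho> \<Longrightarrow> \<psi> x = 1" "\<And>x. 3 * \<rho> \<le> norm (P x - z) \<Longrightarrow> \<psi> x = 0"
      using class_W_disc_cutoff[OF S P, of "2 * \<rho>" "3 * \<rho>" z] \<rho>(1) by auto
    \<comment> \<open>Where the cutoff is strictly between 0 and 1, the local solution k is valid as well, so that
        the convex combination does not destroy what g already achieves on the earlier discs.\<close>
    define G where "G = (\<lambda>x. of_real (\<psi> x) * k x + (1 - of_real (\<psi> x)) * g x)"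
    have "G \<in> class_W" unfolding G_def
      by (intro class_W_add class_W_mult class_W_diff class_W_1 \<psi> k g)
    moreover have "G x = h (f x)" if x: "y \<in> insert z Z" "norm (P x - y) \<le> 2 * \<rho>" for x y
    proof (cases "y = z")
      case True
      thus ?thesis using x \<psi>(4)[of x] k(2)[of x] \<rho>(1) by (simp add: G_def)
    next
      case False
      hence gx: "g x = h (f x)" using x g(2) by blast
      show ?thesis
      proof (cases "norm (P x - z) \<le> 3 * \<rho>")
        case True
        thus ?thesis using k(2)[of x] gx by (simp add: G_def algebra_simps)
      next
        case False
        thus ?thesis using \<psi>(5)[of x] gx by (simp add: G_def)
      qed
    qed
    ultimately show ?case by blast
  qed
  then obtain g where g: "g \<in> class_W" "\<And>x z. z \<in> Z \<Longrightarrow> norm (P x - z) \<le> 2 * \<rho> \<Longrightarrow> g x = h (f x)"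
    by blast
  have "g x = h (f x)" if "f x \<in> K" for x
  proof -
    obtain z where z: "z \<in> Z" "norm (f x - z) < \<rho>"
      using Z(3) \<open>f x \<in> K\<close> by (auto simp: dist_norm norm_minus_commute)
    have "norm (P x - z) \<le> norm (f x - z) + norm (f x - P x)"
      using norm_triangle_ineq4[of "f x - z" "f x - P x"] by simp
    also have "\<dots> \<le> 2 * \<rho>" using z near[of x] by simp
    finally show ?thesis using g(2) z(1) by blast
  qed
  with g(1) show ?thesis by blast
qed

end
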